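(* For any fixed $\eta\in(0,(1-\alpha)/\alpha)$, $$v_t(\eta)\to v(\eta)$$ almost surely and in $L^2$ as $t\to\infty$.
   Context: Fix $\alpha\in(0,1)$, let $\sigma=\sqrt{\alpha(1-\alpha)}$ and $\rho=\sigma/\alpha^{3/2}$. Let $W$ be a standard two-dimensional Brownian motion on $[0,\infty)$, extended by $W(s)=0$ for $s\le0$. For $x>0$, $t>0$ let $$\overline u(x,t)=\mathbb{E}_{Z_{\rho^2x}}W\left(t-\frac x\alpha-Z_{\rho^2x}\right),$$ where $Z_{\rho^2x}$ is a real normal variable with mean $0$ and variance $\rho^2x$ independent of $W$, and the expectation is over $Z_{\rho^2x}$ only, with $W$ fixed. For $\eta\in(0,(1-\alpha)/\alpha)$ put $x_t=\alpha(1+\eta)t$, $\overline v_t(\eta)=\overline u(x_t,t)$, $$v_t(\eta)=\sqrt{2\pi\rho^2\alpha(1+\eta)t}\ \exp\left\{\frac{\eta^2t}{2\rho^2\alpha(1+\eta)}\right\}\overline v_t(\eta),$$ and $$v(\eta)=\int_0^\infty\exp\left\{-\frac{s\eta}{\rho^2\alpha(1+\eta)}\right\}W(s)\,ds .$$ *)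

theory Defs
  imports "HOL-Probability.Probability"
begin

locale std_brownian_motion = prob_space M
  for M :: "'w measure" and B :: "real \<Rightarrow> 'w \<Rightarrow> real" +
  assumes measurable_at: "\<And>t. 0 \<le> t \<Longrightarrow> B t \<in> borel_measurable M"
    and starts_at_0: "AE \<omega> in M. B 0 \<omega> = 0"
    and indep_increments: "\<And>(n::nat) (\<tau> :: nat \<Rightarrow> real).
      0 \<le> \<tau> 0 \<Longrightarrow> mono_on {..n} \<tau> \<Longrightarrow>
      indep_vars (\<lambda>_. borel) (\<lambda>i \<omega>. B (\<tau> (Suc i)) \<omega> - B (\<tau> i) \<omega>) {..<n}"
    and normal_increments: "\<And>s t. 0 \<le> s \<Longrightarrow> s < t \<Longrightarrow>
      distributed M lborel (\<lambda>\<omega>. B t \<omega> - B s \<omega>) (normal_density 0 (sqrt (t - s)))"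
    and continuous_paths: "AE \<omega> in M. continuous_on {0..} (\<lambda>t. B t \<omega>)"

text \<open>The coordinates are independent as processes, i.e. as random elements of the
  product space of functions on \<open>{0..}\<close>.\<close>

locale std_brownian_motion_vec = prob_space M
  for M :: "'w measure" and W :: "real \<Rightarrow> 'w \<Rightarrow> real ^ 'n" +
  assumes coordinate: "\<And>i. std_brownian_motion M (\<lambda>t \<omega>. W t \<omega> $ i)"
    and indep_coordinates:
      "indep_vars (\<lambda>_. PiM {0..} (\<lambda>_. borel)) (\<lambda>i \<omega>. \<lambda>t\<in>{0..}. W t \<omega> $ i) UNIV"

definition ext_path :: "(real \<Rightarrow> 'w \<Rightarrow> real ^ 2) \<Rightarrow> 'w \<Rightarrow> real \<Rightarrow> real ^ 2" where
  "ext_path W \<omega> s = (if s \<le> 0 then 0 else W s \<omega>)"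

definition sigma_par :: "real \<Rightarrow> real" where
  "sigma_par \<alpha> = sqrt (\<alpha> * (1 - \<alpha>))"

definition rho_par :: "real \<Rightarrow> real" where
  "rho_par \<alpha> = sigma_par \<alpha> / \<alpha> powr (3 / 2)"

text \<open>The functions below act on a single fixed path \<open>w\<close>. The expectation over the
  normal variable alone is the integral against its law.\<close>

definition u_bar :: "real \<Rightarrow> (real \<Rightarrow> real ^ 2) \<Rightarrow> real \<Rightarrow> real \<Rightarrow> real ^ 2" where
  "u_bar \<alpha> w x t =
    (LINT z | density lborel (normal_density 0 (sqrt ((rho_par \<alpha>)\<^sup>2 * x))). w (t - x / \<alpha> - z))"

definition v_bar :: "real \<Rightarrow> (real \<Rightarrow> real ^ 2) \<Rightarrow> real \<Rightarrow> real \<Rightarrow> real ^ 2" where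
  "v_bar \<alpha> w t \<eta> = u_bar \<alpha> w (\<alpha> * (1 + \<eta>) * t) t"

definition v_scaled :: "real \<Rightarrow> (real \<Rightarrow> real ^ 2) \<Rightarrow> real \<Rightarrow> real \<Rightarrow> real ^ 2" where
  "v_scaled \<alpha> w t \<eta> =
    (sqrt (2 * pi * (rho_par \<alpha>)\<^sup>2 * \<alpha> * (1 + \<eta>) * t) *
      exp (\<eta>\<^sup>2 * t / (2 * (rho_par \<alpha>)\<^sup>2 * \<alpha> * (1 + \<eta>)))) *\<^sub>R v_bar \<alpha> w t \<eta>"

definition v_limit :: "real \<Rightarrow> (real \<Rightarrow> real ^ 2) \<Rightarrow> real \<Rightarrow> real ^ 2" where
  "v_limit \<alpha> w \<eta> =
    (LINT s : {0..} | lborel. exp (- (s * \<eta>) / ((rho_par \<alpha>)\<^sup>2 * \<alpha> * (1 + \<eta>))) *\<^sub>R w s)"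

text \<open>Membership in $L^2$ is measurability with respect to the completion, i.e. being
  almost everywhere equal to a measurable function: paths are only almost surely
  continuous, so functionals of the whole path need not be measurable for \<open>M\<close> itself.\<close>

definition square_integrable :: "'w measure \<Rightarrow> ('w \<Rightarrow> 'b::euclidean_space) \<Rightarrow> bool" where
  "square_integrable M X \<longleftrightarrow> X \<in> borel_measurable (completion M) \<and>
    integrable (completion M) (\<lambda>\<omega>. (norm (X \<omega>))\<^sup>2)"

definition tendsto_L2 ::
    "'w measure \<Rightarrow> ('t \<Rightarrow> 'w \<Rightarrow> 'b::euclidean_space) \<Rightarrow> ('w \<Rightarrow> 'b) \<Rightarrow> 't filter \<Rightarrow> bool" where
  "tendsto_L2 M X Y F \<longleftrightarrow>
    (\<forall>\<^sub>F t in F. square_integrable M (X t)) \<and> square_integrable M Y \<and>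
    ((\<lambda>t. LINT \<omega> | completion M. (norm (X t \<omega> - Y \<omega>))\<^sup>2) \<longlongrightarrow> 0) F"

end

theory Submission
  imports Defs
begin

text \<open>
  Put \<open>c = \<rho>\<^sup>2 \<alpha> (1 + \<eta>)\<close>. At \<open>x = \<alpha> (1 + \<eta>) t\<close> the smoothing variable has variance \<open>c t\<close>
  and the argument of \<open>W\<close> is \<open>- \<eta> t - z\<close>. Substituting \<open>s = - \<eta> t - z\<close> puts
  \<open>(s + \<eta> t)\<^sup>2 / (2 c t) = \<eta>\<^sup>2 t / (2 c) + s \<eta> / c + s\<^sup>2 / (2 c t)\<close> in the exponent of the normal
  density, and the prefactor in \<open>v_t\<close> is what cancels the term \<open>\<eta>\<^sup>2 t / (2 c)\<close> together with
  the normalisation. Since \<open>W\<close> vanishes on the negative half line, what is left for \<open>t > 0\<close> is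
  the limit integral with one additional factor
  (\<open>normal_density_completed_square\<close>, \<open>v_scaled_eq_damped_Laplace\<close>):
  \<open>v_t = \<integral>\<^sub>0\<^sup>\<infinity> exp (- s\<^sup>2 / (2 c t)) exp (- s \<eta> / c) W(s) ds\<close>.
  The factor lies in \<open>[0, 1]\<close> and tends to \<open>1\<close>, so the theorem is a matter of dominated
  convergence.

  The weight \<open>exp (- s \<eta> / c)\<close> is, up to a constant, an exponential density; let \<open>\<nu>\<close> be that
  probability measure. The second moment of \<open>W(s)\<close> is \<open>2 s\<close>, which is \<open>\<nu>\<close>-integrable, so by
  Tonelli \<open>W\<close> is square integrable over paths and times jointly
  (\<open>integrable_power2_brownian_field\<close>). Almost every path is therefore in \<open>L\<^sup>2(\<nu>)\<close>, hence in
  \<open>L\<^sup>1(\<nu>)\<close>, and dominated convergence in \<open>s\<close> gives the almost sure limit. By Jensen,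
  \<open>|v_t - v|\<^sup>2\<close> is at most a constant times \<open>\<integral> |W|\<^sup>2 d\<nu>\<close>, an integrable random variable that does
  not depend on \<open>t\<close>, and a second dominated convergence, now over paths, gives the limit in
  \<open>L\<^sup>2\<close>. Both steps are \<open>tendsto_damped_average\<close>, which holds for every square
  integrable random field.

  Tonelli needs joint measurability in path and time, whereas only almost every path is
  continuous. The argument is therefore run for a jointly measurable field that has the same
  paths almost surely (\<open>jointly_measurable_modification\<close>), and the conclusion is carried back
  through the completion (\<open>tendsto_L2_cong_AE\<close>).
\<close>

section \<open>Damped averages of a square integrable random field\<close>

text \<open>Jensen for the square of the norm: the variance of \<open>norm X\<close> is nonnegative.\<close>

lemma (in prob_space) norm_expectation_power2_le:
  fixes X :: "'a \<Rightarrow> 'b::{banach, second_countable_topology}"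
  assumes [measurable]: "X \<in> borel_measurable M"
    and sq: "integrable M (\<lambda>\<omega>. (norm (X \<omega>))\<^sup>2)"
  shows "integrable M X" and "(norm (expectation X))\<^sup>2 \<le> expectation (\<lambda>\<omega>. (norm (X \<omega>))\<^sup>2)"
proof -
  have n: "integrable M (\<lambda>\<omega>. norm (X \<omega>))"
    using sq by (rule square_integrable_imp_integrable[rotated]) measurable
  then show "integrable M X"
    by (rule integrable_norm_cancel) simp
  have "(norm (expectation X))\<^sup>2 \<le> (expectation (\<lambda>\<omega>. norm (X \<omega>)))\<^sup>2"
    by (intro power_mono) auto
  also have "\<dots> \<le> expectation (\<lambda>\<omega>. (norm (X \<omega>))\<^sup>2)"
    using variance_positive[of "\<lambda>\<omega>. norm (X \<omega>)"] variance_eq[OF n sq] by simp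
  finally show "(norm (expectation X))\<^sup>2 \<le> expectation (\<lambda>\<omega>. (norm (X \<omega>))\<^sup>2)" .
qed

text \<open>The random variable \<open>Y \<omega> = \<integral> |Z \<omega> s|\<^sup>2 dN\<close> serves twice. It is finite for almost every \<open>\<omega>\<close>,
  which makes \<open>Z \<omega>\<close> itself an integrable bound for dominated convergence in \<open>s\<close>. By Jensen it
  also bounds the square of every average of \<open>Z \<omega>\<close> with weights in \<open>[-1, 1]\<close>; the difference
  \<open>A t - L\<close> is such an average, with weight \<open>k t - 1\<close>, so \<open>Y\<close> is the bound for
  dominated convergence in \<open>\<omega>\<close>.\<close>

lemma tendsto_damped_average:
  fixes Z :: "'w \<Rightarrow> 's \<Rightarrow> 'b::{banach, second_countable_topology}"
    and k :: "real \<Rightarrow> 's \<Rightarrow> real"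
  assumes "prob_space M" and "prob_space N"
    and Z[measurable]: "case_prod Z \<in> borel_measurable (M \<Otimes>\<^sub>M N)"
    and sq: "integrable (M \<Otimes>\<^sub>M N) (\<lambda>(\<omega>, s). (norm (Z \<omega> s))\<^sup>2)"
    and k[measurable]: "\<And>t. k t \<in> borel_measurable N"
    and bounds: "\<forall>\<^sub>F t in at_top. \<forall>s. 0 \<le> k t s \<and> k t s \<le> 1"
    and lim: "\<And>s. ((\<lambda>t. k t s) \<longlongrightarrow> 1) at_top"
  defines "A \<equiv> \<lambda>t \<omega>. LINT s|N. k t s *\<^sub>R Z \<omega> s"
    and "L \<equiv> \<lambda>\<omega>. LINT s|N. Z \<omega> s"
  shows "AE \<omega> in M. ((\<lambda>t. A t \<omega>) \<longlongrightarrow> L \<omega>) at_top"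
    and "\<And>t. A t \<in> borel_measurable M" and "L \<in> borel_measurable M"
    and "\<forall>\<^sub>F t in at_top. integrable M (\<lambda>\<omega>. (norm (A t \<omega>))\<^sup>2)"
    and "integrable M (\<lambda>\<omega>. (norm (L \<omega>))\<^sup>2)"
    and "((\<lambda>t. LINT \<omega>|M. (norm (A t \<omega> - L \<omega>))\<^sup>2) \<longlongrightarrow> 0) at_top"
proof -
  interpret M: prob_space M by fact
  interpret N: prob_space N by fact
  interpret P: pair_sigma_finite M N ..
  define Y where "Y = (\<lambda>\<omega>. LINT s|N. (norm (Z \<omega> s))\<^sup>2)"
  have Y: "integrable M Y"
    using P.integrable_fst'[OF sq] by (simp add: Y_def)
  have section_sq: "AE \<omega> in M. integrable N (\<lambda>s. (norm (Z \<omega> s))\<^sup>2)"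
    using P.AE_integrable_fst'[OF sq] by simp
  show A[measurable]: "A t \<in> borel_measurable M" for t
    unfolding A_def by measurable
  show L[measurable]: "L \<in> borel_measurable M"
    unfolding L_def by measurable
  have weighted: "integrable N (\<lambda>s. g s *\<^sub>R Z \<omega> s)"
      "(norm (LINT s|N. g s *\<^sub>R Z \<omega> s))\<^sup>2 \<le> Y \<omega>"
    if "\<omega> \<in> space M" and int: "integrable N (\<lambda>s. (norm (Z \<omega> s))\<^sup>2)"
      and [measurable]: "g \<in> borel_measurable N" and g: "\<And>s. \<bar>g s\<bar> \<le> 1" for g \<omega>
  proof -
    have [measurable]: "Z \<omega> \<in> borel_measurable N"
      using that(1) by measurable
    have le: "(norm (g s *\<^sub>R Z \<omega> s))\<^sup>2 \<le> (norm (Z \<omega> s))\<^sup>2" for s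
      using mult_right_mono[OF g[of s], of "norm (Z \<omega> s)"] by (intro power_mono) auto
    have int': "integrable N (\<lambda>s. (norm (g s *\<^sub>R Z \<omega> s))\<^sup>2)"
      by (rule Bochner_Integration.integrable_bound[OF int]) (use le in auto)
    show "integrable N (\<lambda>s. g s *\<^sub>R Z \<omega> s)"
      by (rule N.norm_expectation_power2_le(1)) (use int' in auto)
    have "(norm (LINT s|N. g s *\<^sub>R Z \<omega> s))\<^sup>2 \<le> (LINT s|N. (norm (g s *\<^sub>R Z \<omega> s))\<^sup>2)"
      by (rule N.norm_expectation_power2_le(2)) (use int' in auto)
    also have "\<dots> \<le> Y \<omega>"
      unfolding Y_def by (rule integral_mono[OF int' int le])
    finally show "(norm (LINT s|N. g s *\<^sub>R Z \<omega> s))\<^sup>2 \<le> Y \<omega>" .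
  qed
  show lim_AE: "AE \<omega> in M. ((\<lambda>t. A t \<omega>) \<longlongrightarrow> L \<omega>) at_top"
    using section_sq AE_space
  proof eventually_elim
    case (elim \<omega>)
    have [measurable]: "Z \<omega> \<in> borel_measurable N"
      using elim(2) by measurable
    show ?case
      unfolding A_def L_def
    proof (rule integral_dominated_convergence_at_top)
      show "integrable N (\<lambda>s. norm (Z \<omega> s))"
        using weighted(1)[OF elim(2,1), of "\<lambda>_. 1"] by (intro integrable_norm) simp
      show "AE s in N. ((\<lambda>t. k t s *\<^sub>R Z \<omega> s) \<longlongrightarrow> Z \<omega> s) at_top"
      proof (rule AE_I2)
        fix s
        show "((\<lambda>t. k t s *\<^sub>R Z \<omega> s) \<longlongrightarrow> Z \<omega> s) at_top"
          using tendsto_scaleR[OF lim[of s] tendsto_const[of "Z \<omega> s"]] by simp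
      qed
      show "\<forall>\<^sub>F t in at_top. AE s in N. norm (k t s *\<^sub>R Z \<omega> s) \<le> norm (Z \<omega> s)"
        using bounds by eventually_elim (auto intro!: mult_left_le_one_le)
    qed measurable
  qed
  have sq_int: "integrable M (\<lambda>\<omega>. (norm (F \<omega>))\<^sup>2)"
    if [measurable]: "F \<in> borel_measurable M"
      and "AE \<omega> in M. (norm (F \<omega>))\<^sup>2 \<le> Y \<omega>" for F :: "'w \<Rightarrow> 'b"
  proof (rule Bochner_Integration.integrable_bound[OF Y])
    show "AE \<omega> in M. norm ((norm (F \<omega>))\<^sup>2) \<le> norm (Y \<omega>)"
      using that(2) by eventually_elim simp
  qed measurable
  show "\<forall>\<^sub>F t in at_top. integrable M (\<lambda>\<omega>. (norm (A t \<omega>))\<^sup>2)"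
    using bounds
  proof eventually_elim
    case (elim t)
    show ?case
    proof (rule sq_int[OF A])
      show "AE \<omega> in M. (norm (A t \<omega>))\<^sup>2 \<le> Y \<omega>"
        using section_sq AE_space
        by eventually_elim (use elim in \<open>auto simp: A_def intro!: weighted(2)\<close>)
    qed
  qed
  show "integrable M (\<lambda>\<omega>. (norm (L \<omega>))\<^sup>2)"
  proof (rule sq_int[OF L])
    show "AE \<omega> in M. (norm (L \<omega>))\<^sup>2 \<le> Y \<omega>"
      using section_sq AE_space
    proof eventually_elim
      case (elim \<omega>)
      then show ?case
        using weighted(2)[of \<omega> "\<lambda>_. 1"] by (simp add: L_def)
    qed
  qed
  have "((\<lambda>t. LINT \<omega>|M. (norm (A t \<omega> - L \<omega>))\<^sup>2) \<longlongrightarrow> (LINT \<omega>|M. 0)) at_top"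
  proof (rule integral_dominated_convergence_at_top[OF _ _ Y])
    show "AE \<omega> in M. ((\<lambda>t. (norm (A t \<omega> - L \<omega>))\<^sup>2) \<longlongrightarrow> 0) at_top"
      using lim_AE
    proof eventually_elim
      case (elim \<omega>)
      from tendsto_power[OF tendsto_norm_zero[OF LIM_zero[OF elim]], of 2]
      show ?case by simp
    qed
    show "\<forall>\<^sub>F t in at_top. AE \<omega> in M. norm ((norm (A t \<omega> - L \<omega>))\<^sup>2) \<le> Y \<omega>"
      using bounds
    proof eventually_elim
      case k01: (elim t)
      show ?case
        using section_sq AE_space
      proof eventually_elim
        case (elim \<omega>)
        have "integrable N (\<lambda>s. k t s *\<^sub>R Z \<omega> s)"
          by (rule weighted(1)[OF elim(2,1) k]) (use k01 in auto)
        moreover have "integrable N (Z \<omega>)"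
          using weighted(1)[OF elim(2,1), of "\<lambda>_. 1"] by simp
        ultimately have "A t \<omega> - L \<omega> = (LINT s|N. (k t s - 1) *\<^sub>R Z \<omega> s)"
          by (simp add: A_def L_def scaleR_left_diff_distrib)
        moreover have "\<bar>k t s - 1\<bar> \<le> 1" for s
          using k01[rule_format, of s] by auto
        ultimately show ?case
          using weighted(2)[OF elim(2,1), of "\<lambda>s. k t s - 1"] by simp
      qed
    qed
  qed measurable
  then show "((\<lambda>t. LINT \<omega>|M. (norm (A t \<omega> - L \<omega>))\<^sup>2) \<longlongrightarrow> 0) at_top"
    by simp
qed

section \<open>Gaussian smoothing as a Laplace transform\<close>

lemma LINT_exponential_density:
  fixes f :: "real \<Rightarrow> 'b::{banach, second_countable_topology}"
  assumes "0 < a" and [measurable]: "f \<in> borel_measurable borel"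
  shows "(LINT s|density lborel (exponential_density a). f s)
    = a *\<^sub>R (LINT s:{0..}|lborel. exp (- (s * a)) *\<^sub>R f s)"
proof -
  have "(LINT s|density lborel (exponential_density a). f s)
      = (LINT s|lborel. exponential_density a s *\<^sub>R f s)"
    using assms(1) by (intro integral_density) (auto simp: exponential_density_nonneg)
  also have "\<dots> = (LINT s|lborel. a *\<^sub>R (indicator {0..} s *\<^sub>R (exp (- (s * a)) *\<^sub>R f s)))"
    by (intro Bochner_Integration.integral_cong) (auto simp: exponential_density_def)
  finally show ?thesis
    by (simp only: set_lebesgue_integral_def integral_scaleR_right)
qed

text \<open>Expanding the square in the exponent splits off \<open>exp (- \<eta>\<^sup>2 t / (2 c))\<close>, so the prefactor
  leaves a Laplace kernel of rate \<open>\<eta> / c\<close> and a Gaussian factor that flattens out as \<open>t\<close> grows.\<close>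

lemma normal_density_completed_square:
  fixes c t \<eta> s :: real
  assumes "0 < c" and "0 < t"
  shows "sqrt (2 * pi * c * t) * exp (\<eta>\<^sup>2 * t / (2 * c)) * normal_density 0 (sqrt (c * t)) (- (\<eta> * t) - s)
    = exp (- (s * (\<eta> / c))) * exp (- s\<^sup>2 / (2 * c * t))"
proof -
  have "\<eta>\<^sup>2 * t / (2 * c) + - (- (\<eta> * t) - s)\<^sup>2 / (2 * (c * t))
      = - (s * (\<eta> / c)) + - s\<^sup>2 / (2 * c * t)"
    using assms by (simp add: field_simps power2_eq_square)
  then have "exp (\<eta>\<^sup>2 * t / (2 * c)) * exp (- (- (\<eta> * t) - s)\<^sup>2 / (2 * (c * t)))
      = exp (- (s * (\<eta> / c))) * exp (- s\<^sup>2 / (2 * c * t))"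
    by (simp only: exp_add[symmetric])
  moreover have "normal_density 0 (sqrt (c * t)) x = exp (- x\<^sup>2 / (2 * (c * t))) / sqrt (2 * pi * c * t)" for x
    using assms by (simp add: normal_density_def mult.assoc)
  ultimately show ?thesis
    using assms by simp
qed

text \<open>The reflection \<open>z = - \<eta> t - s\<close> moves all dependence on \<open>t\<close> from the path into the kernel.\<close>

lemma v_scaled_eq_damped_Laplace:
  fixes w :: "real \<Rightarrow> real ^ 2"
  assumes [measurable]: "w \<in> borel_measurable borel" and w0: "\<And>s. s \<le> 0 \<Longrightarrow> w s = 0"
    and \<alpha>: "0 < \<alpha>" and t: "0 < t"
    and c: "0 < c" and c_eq: "c = (rho_par \<alpha>)\<^sup>2 * \<alpha> * (1 + \<eta>)"
  shows "v_scaled \<alpha> w t \<eta>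
    = (LINT s:{0..}|lborel. exp (- (s * (\<eta> / c))) *\<^sub>R (exp (- s\<^sup>2 / (2 * c * t)) *\<^sub>R w s))"
proof -
  define K where "K = sqrt (2 * pi * c * t) * exp (\<eta>\<^sup>2 * t / (2 * c))"
  have "v_bar \<alpha> w t \<eta> = (LINT z|density lborel (normal_density 0 (sqrt (c * t))). w (- (\<eta> * t) - z))"
  proof -
    have "t - \<alpha> * (1 + \<eta>) * t / \<alpha> - z = - (\<eta> * t) - z" for z
      using \<alpha> by (simp add: field_simps)
    moreover have "(rho_par \<alpha>)\<^sup>2 * (\<alpha> * (1 + \<eta>) * t) = c * t"
      by (simp add: c_eq mult_ac)
    ultimately show ?thesis
      by (simp only: v_bar_def u_bar_def)
  qed
  also have "\<dots> = (LINT z|lborel. normal_density 0 (sqrt (c * t)) z *\<^sub>R w (- (\<eta> * t) - z))"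
    by (rule integral_density) auto
  also have "\<dots> = (LINT s|lborel. normal_density 0 (sqrt (c * t)) (- (\<eta> * t) - s) *\<^sub>R w s)"
    by (subst lborel_integral_real_affine[where c = "-1" and t = "- (\<eta> * t)"]) auto
  finally have "v_scaled \<alpha> w t \<eta>
      = K *\<^sub>R (LINT s|lborel. normal_density 0 (sqrt (c * t)) (- (\<eta> * t) - s) *\<^sub>R w s)"
    by (simp add: v_scaled_def K_def c_eq mult.assoc)
  also have "\<dots> = (LINT s|lborel. (K * normal_density 0 (sqrt (c * t)) (- (\<eta> * t) - s)) *\<^sub>R w s)"
    by (simp add: scaleR_scaleR[symmetric] del: scaleR_scaleR)
  also have "\<dots> = (LINT s|lborel. indicator {0..} s *\<^sub>R
      (exp (- (s * (\<eta> / c))) *\<^sub>R (exp (- s\<^sup>2 / (2 * c * t)) *\<^sub>R w s)))"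
    unfolding K_def normal_density_completed_square[OF c t]
    by (intro Bochner_Integration.integral_cong) (auto simp: w0 split: split_indicator)
  finally show ?thesis
    by (simp add: set_lebesgue_integral_def)
qed

section \<open>Planar Brownian motion as a square integrable random field\<close>

text \<open>Rounding the time down to a multiple of \<open>1 / (n + 1)\<close> leaves countably many values, so the
  rounded process is jointly measurable; by continuity of the paths it converges to the process.\<close>

lemma borel_measurable_continuous_process:
  fixes X :: "real \<Rightarrow> 'w \<Rightarrow> 'b::{metric_space}"
  assumes X: "\<And>s. X s \<in> borel_measurable M"
    and cont: "\<And>\<omega>. \<omega> \<in> space M \<Longrightarrow> continuous_on UNIV (\<lambda>s. X s \<omega>)"
  shows "(\<lambda>(\<omega>, s). X s \<omega>) \<in> borel_measurable (M \<Otimes>\<^sub>M borel)"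
proof (rule borel_measurable_LIMSEQ_metric)
  define r :: "nat \<Rightarrow> real \<Rightarrow> real" where "r = (\<lambda>n s. of_int \<lfloor>real (Suc n) * s\<rfloor> / real (Suc n))"
  show "(\<lambda>(\<omega>, s). X (r n s) \<omega>) \<in> borel_measurable (M \<Otimes>\<^sub>M borel)" for n
  proof -
    have "(\<lambda>p. X (of_int i / real (Suc n)) (fst p)) \<in> borel_measurable (M \<Otimes>\<^sub>M borel)" for i :: int
      using X by (rule measurable_compose[OF measurable_fst])
    moreover have "(\<lambda>p. \<lfloor>real (Suc n) * snd p\<rfloor>) \<in> (M \<Otimes>\<^sub>M borel) \<rightarrow>\<^sub>M count_space UNIV"
      by measurable
    ultimately have "(\<lambda>p. X (of_int \<lfloor>real (Suc n) * snd p\<rfloor> / real (Suc n)) (fst p))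
        \<in> borel_measurable (M \<Otimes>\<^sub>M borel)"
      by (rule measurable_compose_countable)
    then show ?thesis
      by (simp add: r_def case_prod_beta)
  qed
  show "(\<lambda>n. case p of (\<omega>, s) \<Rightarrow> X (r n s) \<omega>) \<longlonglongrightarrow> (case p of (\<omega>, s) \<Rightarrow> X s \<omega>)"
    if "p \<in> space (M \<Otimes>\<^sub>M borel)" for p
  proof -
    obtain \<omega> s where p: "p = (\<omega>, s)" "\<omega> \<in> space M"
      using \<open>p \<in> _\<close> by (auto simp: space_pair_measure)
    have "(\<lambda>n. r n s) \<longlonglongrightarrow> s"
    proof (rule tendsto_sandwich)
      have "s - 1 / real (Suc n) \<le> r n s \<and> r n s \<le> s" for n
      proof
        have "s - 1 / real (Suc n) = (real (Suc n) * s - 1) / real (Suc n)"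
          by (simp add: field_simps)
        also have "\<dots> \<le> r n s"
          unfolding r_def by (intro divide_right_mono) linarith+
        finally show "s - 1 / real (Suc n) \<le> r n s" .
        have "r n s \<le> (real (Suc n) * s) / real (Suc n)"
          unfolding r_def by (intro divide_right_mono) linarith+
        then show "r n s \<le> s"
          by simp
      qed
      then show "\<forall>\<^sub>F n in sequentially. s - 1 / real (Suc n) \<le> r n s"
          "\<forall>\<^sub>F n in sequentially. r n s \<le> s"
        by auto
      show "(\<lambda>n. s - 1 / real (Suc n)) \<longlonglongrightarrow> s"
        using tendsto_diff[OF tendsto_const LIMSEQ_inverse_real_of_nat, of s]
        by (simp add: inverse_eq_divide)
    qed simp
    then have "(\<lambda>n. X (r n s) \<omega>) \<longlonglongrightarrow> X s \<omega>"
      by (rule continuous_on_tendsto_compose[OF cont[OF p(2)]]) auto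
    then show ?thesis
      by (simp add: p)
  qed
qed

lemma (in std_brownian_motion) second_moment:
  assumes "0 \<le> s"
  shows "integrable M (\<lambda>\<omega>. (B s \<omega>)\<^sup>2)" and "expectation (\<lambda>\<omega>. (B s \<omega>)\<^sup>2) = s"
proof -
  note [measurable] = measurable_at[OF assms] measurable_at[OF order_refl]
  have "integrable M (\<lambda>\<omega>. (B s \<omega>)\<^sup>2) \<and> expectation (\<lambda>\<omega>. (B s \<omega>)\<^sup>2) = s"
  proof (cases "s = 0")
    case True
    then have eq: "AE \<omega> in M. (B s \<omega>)\<^sup>2 = 0"
      using starts_at_0 by auto
    have "integrable M (\<lambda>\<omega>. (B s \<omega>)\<^sup>2) \<longleftrightarrow> integrable M (\<lambda>\<omega>. 0::real)"
      by (rule integrable_cong_AE) (use eq in auto)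
    moreover have "expectation (\<lambda>\<omega>. (B s \<omega>)\<^sup>2) = expectation (\<lambda>\<omega>. 0)"
      by (rule integral_cong_AE) (use eq in auto)
    ultimately show ?thesis
      using True by simp
  next
    case False
    with assms have s: "0 < s" by simp
    have D: "distributed M lborel (\<lambda>\<omega>. B s \<omega> - B 0 \<omega>) (normal_density 0 (sqrt s))"
      using normal_increments[of 0 s] s by simp
    have eq: "AE \<omega> in M. (B s \<omega>)\<^sup>2 = (B s \<omega> - B 0 \<omega>)\<^sup>2"
      using starts_at_0 by eventually_elim simp
    have "integrable lborel (\<lambda>x. normal_density 0 (sqrt s) x * x\<^sup>2)"
      using integrable_normal_moment[of "sqrt s" 0 2] s by simp
    then have "integrable M (\<lambda>\<omega>. (B s \<omega> - B 0 \<omega>)\<^sup>2)"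
      using distributed_integrable[OF D, of "\<lambda>x. x\<^sup>2"] by simp
    moreover have "(LINT x|lborel. normal_density 0 (sqrt s) x * x\<^sup>2) = s"
      using integral_normal_moment_even[of "sqrt s" 0 1] s by simp
    then have "expectation (\<lambda>\<omega>. (B s \<omega> - B 0 \<omega>)\<^sup>2) = s"
      using distributed_integral[OF D, of "\<lambda>x. x\<^sup>2"] by simp
    ultimately show ?thesis
      using integrable_cong_AE[OF _ _ eq] integral_cong_AE[OF _ _ eq] by simp
  qed
  then show "integrable M (\<lambda>\<omega>. (B s \<omega>)\<^sup>2)" and "expectation (\<lambda>\<omega>. (B s \<omega>)\<^sup>2) = s"
    by auto
qed

lemma (in std_brownian_motion_vec) second_moment_vec:
  fixes s :: real
  assumes "0 \<le> s"
  shows "integrable M (\<lambda>\<omega>. (norm (W s \<omega>))\<^sup>2)"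
    and "expectation (\<lambda>\<omega>. (norm (W s \<omega>))\<^sup>2) = CARD('n) * s"
proof -
  have eq: "(norm v)\<^sup>2 = (\<Sum>i\<in>UNIV. (v $ i)\<^sup>2)" for v :: "real ^ 'n"
    by (simp add: norm_vec_def L2_set_def sum_nonneg)
  note m = std_brownian_motion.second_moment[OF coordinate assms]
  show "integrable M (\<lambda>\<omega>. (norm (W s \<omega>))\<^sup>2)"
    unfolding eq by (intro Bochner_Integration.integrable_sum m)
  show "expectation (\<lambda>\<omega>. (norm (W s \<omega>))\<^sup>2) = CARD('n) * s"
    unfolding eq by (simp add: m)
qed

lemma (in std_brownian_motion_vec) random_vector_at:
  assumes "0 \<le> s"
  shows "W s \<in> borel_measurable M"
  using std_brownian_motion.measurable_at[OF coordinate assms]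
  by (intro borel_measurable_euclidean_space[THEN iffD2]) (auto simp: Basis_vec_def inner_axis)

lemma (in std_brownian_motion_vec) AE_continuous_from_0:
  "AE \<omega> in M. W 0 \<omega> = 0 \<and> continuous_on {0..} (\<lambda>s. W s \<omega>)"
proof -
  have "AE \<omega> in M. \<forall>i\<in>UNIV. W 0 \<omega> $ i = 0 \<and> continuous_on {0..} (\<lambda>s. W s \<omega> $ i)"
    using std_brownian_motion.starts_at_0[OF coordinate]
      std_brownian_motion.continuous_paths[OF coordinate]
    by (intro AE_finite_allI) auto
  then show ?thesis
  proof eventually_elim
    case (elim \<omega>)
    then have "continuous_on {0..} (\<lambda>s. \<chi> i. W s \<omega> $ i)"
      by (intro continuous_on_vec_lambda) auto
    then show ?case
      using elim by (auto simp: vec_eq_iff vec_lambda_eta)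
  qed
qed

text \<open>Replacing the paths on a null set by \<open>0\<close> makes every path continuous on the whole line,
  including at time \<open>0\<close>, where the zero extension to the left meets \<open>W 0 = 0\<close>.\<close>

lemma jointly_measurable_modification:
  fixes W :: "real \<Rightarrow> 'w \<Rightarrow> real ^ 2"
  assumes "std_brownian_motion_vec M W"
  obtains Z where "case_prod Z \<in> borel_measurable (M \<Otimes>\<^sub>M borel)"
    and "AE \<omega> in M. ext_path W \<omega> = Z \<omega>" and "\<And>\<omega> s. s \<le> 0 \<Longrightarrow> Z \<omega> s = 0"
proof -
  interpret std_brownian_motion_vec M W by fact
  obtain N where N: "N \<in> null_sets M"
    and good: "\<And>\<omega>. \<omega> \<in> space M - N \<Longrightarrow> W 0 \<omega> = 0 \<and> continuous_on {0..} (\<lambda>s. W s \<omega>)"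
    using AE_continuous_from_0 by (rule AE_E3) blast
  have [measurable]: "N \<in> sets M"
    using N by auto
  define Z where "Z = (\<lambda>\<omega> s. if \<omega> \<in> N then 0 else ext_path W \<omega> s)"
  have "(\<lambda>(\<omega>, s). Z \<omega> s) \<in> borel_measurable (M \<Otimes>\<^sub>M borel)"
  proof (rule borel_measurable_continuous_process)
    fix s :: real
    have "W (max 0 s) \<in> borel_measurable M"
      by (rule random_vector_at) simp
    moreover have "(\<lambda>\<omega>. Z \<omega> s) = (\<lambda>\<omega>. if \<omega> \<in> N then 0 else if s \<le> 0 then 0 else W (max 0 s) \<omega>)"
      by (auto simp: Z_def ext_path_def max_def fun_eq_iff)
    ultimately show "(\<lambda>\<omega>. Z \<omega> s) \<in> borel_measurable M"
      by simp
  next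
    fix \<omega> assume \<omega>: "\<omega> \<in> space M"
    show "continuous_on UNIV (\<lambda>s. Z \<omega> s)"
    proof (cases "\<omega> \<in> N")
      case False
      with \<omega> good have W: "W 0 \<omega> = 0" "continuous_on {0..} (\<lambda>s. W s \<omega>)"
        by auto
      have "continuous_on UNIV (\<lambda>s. W (max 0 s) \<omega>)"
        by (rule continuous_on_compose2[OF W(2)]) (auto intro!: continuous_intros)
      also have "(\<lambda>s. W (max 0 s) \<omega>) = (\<lambda>s. Z \<omega> s)"
        using W(1) False by (auto simp: Z_def ext_path_def max_def fun_eq_iff)
      finally show ?thesis .
    qed (simp add: Z_def)
  qed
  moreover have "AE \<omega> in M. ext_path W \<omega> = Z \<omega>"
    using AE_not_in[OF N] by eventually_elim (auto simp: Z_def)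
  ultimately show ?thesis
    by (rule that) (auto simp: Z_def ext_path_def)
qed

text \<open>Integrating over paths first gives \<open>2 max 0 s\<close>, and the exponential distribution has a finite mean.\<close>

lemma integrable_power2_brownian_field:
  fixes W :: "real \<Rightarrow> 'w \<Rightarrow> real ^ 2"
  assumes W: "std_brownian_motion_vec M W" and a: "0 < a"
    and Z[measurable]: "case_prod Z \<in> borel_measurable (M \<Otimes>\<^sub>M borel)"
    and eq: "AE \<omega> in M. ext_path W \<omega> = Z \<omega>"
  shows "integrable (M \<Otimes>\<^sub>M density lborel (exponential_density a)) (\<lambda>(\<omega>, s). (norm (Z \<omega> s))\<^sup>2)"
proof -
  interpret std_brownian_motion_vec M W by fact
  define \<nu> where "\<nu> = density lborel (exponential_density a)"
  have [measurable_cong]: "sets \<nu> = sets borel"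
    by (simp add: \<nu>_def)
  interpret \<nu>: prob_space \<nu>
    unfolding \<nu>_def by (rule prob_space_exponential_density[OF a])
  interpret P: pair_sigma_finite \<nu> M ..
  have moment: "integrable M (\<lambda>\<omega>. (norm (Z \<omega> s))\<^sup>2) \<and>
      expectation (\<lambda>\<omega>. (norm (Z \<omega> s))\<^sup>2) = 2 * max 0 s" for s
  proof -
    have m[measurable]: "W (max 0 s) \<in> borel_measurable M"
      by (rule random_vector_at) simp
    have "AE \<omega> in M. (norm (Z \<omega> s))\<^sup>2 = (norm (W (max 0 s) \<omega>))\<^sup>2"
      using eq AE_continuous_from_0
    proof eventually_elim
      case (elim \<omega>)
      show ?case
        using fun_cong[OF elim(1), of s] elim(2)
        by (cases "s = 0") (auto simp: ext_path_def max_def)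
    qed
    from integrable_cong_AE[OF _ _ this] integral_cong_AE[OF _ _ this] show ?thesis
      using second_moment_vec[of "max 0 s"] by simp
  qed
  have "distributed \<nu> lborel (\<lambda>s. s) (exponential_density a)"
    unfolding distributed_def \<nu>_def
    using a by (auto simp: distr_id2 exponential_density_nonneg)
  from \<nu>.erlang_ith_moment_integrable[OF a this, of 1] have "integrable \<nu> (\<lambda>s. s)"
    by simp
  then have mean: "integrable \<nu> (\<lambda>s. 2 * max 0 s)"
    by (intro integrable_mult_right integrable_max) auto
  have "integrable (\<nu> \<Otimes>\<^sub>M M) (\<lambda>(s, \<omega>). (norm (Z \<omega> s))\<^sup>2)"
    by (rule P.Fubini_integrable) (use moment mean in auto)
  then show ?thesis
    using P.integrable_product_swap_iff[of "\<lambda>(s, \<omega>). (norm (Z \<omega> s))\<^sup>2"] by (simp add: \<nu>_def)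
qed

section \<open>Convergence of the rescaled field\<close>

lemma borel_measurable_completion_cong_AE:
  fixes X X' :: "'w \<Rightarrow> 'b::topological_space"
  assumes [measurable]: "X' \<in> borel_measurable M" and eq: "AE \<omega> in M. X \<omega> = X' \<omega>"
  shows "X \<in> borel_measurable (completion M)"
proof (rule measurableI)
  fix S :: "'b set" assume [measurable]: "S \<in> sets borel"
  show "X -` S \<inter> space (completion M) \<in> sets (completion M)"
  proof (rule completion.in_sets_AE)
    show "AE \<omega> in completion M. (\<omega> \<in> X' -` S \<inter> space M) = (\<omega> \<in> X -` S \<inter> space (completion M))"
      using AE_completion[OF eq] by eventually_elim auto
    show "X' -` S \<inter> space M \<in> sets (completion M)"
      by (intro sets_completionI_sets) measurable
  qed auto
qed simp

lemma square_integrable_cong_AE: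
  assumes X'[measurable]: "X' \<in> borel_measurable M" and eq: "AE \<omega> in M. X \<omega> = X' \<omega>"
    and int: "integrable M (\<lambda>\<omega>. (norm (X' \<omega>))\<^sup>2)"
  shows "square_integrable M X"
proof -
  note X[measurable] = borel_measurable_completion_cong_AE[OF X' eq]
  note X'_completion[measurable] = measurable_completion[OF X']
  have "integrable (completion M) (\<lambda>\<omega>. (norm (X' \<omega>))\<^sup>2)"
    using int by (subst integrable_completion) auto
  moreover have "AE \<omega> in completion M. (norm (X' \<omega>))\<^sup>2 = (norm (X \<omega>))\<^sup>2"
    using AE_completion[OF eq] by eventually_elim simp
  ultimately show ?thesis
    using integrable_cong_AE[of "\<lambda>\<omega>. (norm (X' \<omega>))\<^sup>2" "completion M" "\<lambda>\<omega>. (norm (X \<omega>))\<^sup>2"] X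
    by (simp add: square_integrable_def)
qed

text \<open>Here \<open>X'\<close> and \<open>Y'\<close> are measurable for \<open>M\<close>, so their integrals may be computed there, while
  \<open>X\<close> and \<open>Y\<close> are measurable only for the completion.\<close>

lemma tendsto_L2_cong_AE:
  assumes X'[measurable]: "\<And>t. X' t \<in> borel_measurable M" and Y'[measurable]: "Y' \<in> borel_measurable M"
    and eqX: "\<forall>\<^sub>F t in F. AE \<omega> in M. X t \<omega> = X' t \<omega>" and eqY: "AE \<omega> in M. Y \<omega> = Y' \<omega>"
    and intX: "\<forall>\<^sub>F t in F. integrable M (\<lambda>\<omega>. (norm (X' t \<omega>))\<^sup>2)"
    and intY: "integrable M (\<lambda>\<omega>. (norm (Y' \<omega>))\<^sup>2)"
    and lim: "((\<lambda>t. LINT \<omega>|M. (norm (X' t \<omega> - Y' \<omega>))\<^sup>2) \<longlongrightarrow> 0) F"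
  shows "tendsto_L2 M X Y F"
  unfolding tendsto_L2_def
proof (intro conjI)
  show "\<forall>\<^sub>F t in F. square_integrable M (X t)"
    using eqX intX by eventually_elim (rule square_integrable_cong_AE[OF X'])
  show "square_integrable M Y"
    using Y' eqY intY by (rule square_integrable_cong_AE)
  note [measurable] = borel_measurable_completion_cong_AE[OF Y' eqY]
    measurable_completion[OF X'] measurable_completion[OF Y']
  have "\<forall>\<^sub>F t in F. (LINT \<omega>|M. (norm (X' t \<omega> - Y' \<omega>))\<^sup>2)
      = (LINT \<omega>|completion M. (norm (X t \<omega> - Y \<omega>))\<^sup>2)"
    using eqX
  proof eventually_elim
    case (elim t)
    note [measurable] = borel_measurable_completion_cong_AE[OF X' elim]
    have "(LINT \<omega>|M. (norm (X' t \<omega> - Y' \<omega>))\<^sup>2) = (LINT \<omega>|completion M. (norm (X' t \<omega> - Y' \<omega>))\<^sup>2)"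
      by (rule integral_completion[symmetric]) measurable
    also have "\<dots> = (LINT \<omega>|completion M. (norm (X t \<omega> - Y \<omega>))\<^sup>2)"
    proof (rule integral_cong_AE)
      show "AE \<omega> in completion M. (norm (X' t \<omega> - Y' \<omega>))\<^sup>2 = (norm (X t \<omega> - Y \<omega>))\<^sup>2"
        using AE_completion[OF elim] AE_completion[OF eqY] by eventually_elim simp
    qed measurable
    finally show ?case .
  qed
  from Lim_transform_eventually[OF lim this]
  show "((\<lambda>t. LINT \<omega>|completion M. (norm (X t \<omega> - Y \<omega>))\<^sup>2) \<longlongrightarrow> 0) F" .
qed

theorem theorem9:
  fixes M :: "'w measure" and W :: "real \<Rightarrow> 'w \<Rightarrow> real ^ 2" and \<alpha> \<eta> :: real
  assumes "0 < \<alpha>" and "\<alpha> < 1"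
    and "std_brownian_motion_vec M W"
    and "0 < \<eta>" and "\<eta> < (1 - \<alpha>) / \<alpha>"
  shows "(AE \<omega> in M. ((\<lambda>t. v_scaled \<alpha> (ext_path W \<omega>) t \<eta>)
            \<longlongrightarrow> v_limit \<alpha> (ext_path W \<omega>) \<eta>) at_top)
    \<and> tendsto_L2 M (\<lambda>t \<omega>. v_scaled \<alpha> (ext_path W \<omega>) t \<eta>)
         (\<lambda>\<omega>. v_limit \<alpha> (ext_path W \<omega>) \<eta>) at_top"
proof -
  interpret std_brownian_motion_vec M W by fact
  define c where "c = (rho_par \<alpha>)\<^sup>2 * \<alpha> * (1 + \<eta>)"
  define a where "a = \<eta> / c"
  define \<nu> where "\<nu> = density lborel (exponential_density a)"
  define k where "k = (\<lambda>t s. exp (- s\<^sup>2 / (2 * c * t)))"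
  have "rho_par \<alpha> \<noteq> 0"
    using assms by (simp add: rho_par_def sigma_par_def)
  then have c: "0 < c"
    using assms by (simp add: c_def)
  then have a: "0 < a"
    using assms by (simp add: a_def)
  have [measurable_cong]: "sets \<nu> = sets borel"
    by (simp add: \<nu>_def)
  obtain Z where Z: "case_prod Z \<in> borel_measurable (M \<Otimes>\<^sub>M borel)"
    and eq: "AE \<omega> in M. ext_path W \<omega> = Z \<omega>" and Z0: "\<And>\<omega> s. s \<le> 0 \<Longrightarrow> Z \<omega> s = 0"
    using jointly_measurable_modification[OF assms(3)] by blast
  \<comment> \<open>The factor \<open>1 / a\<close>, which undoes the normalisation of the exponential density, is put
    into the field, so that both objects become plain averages against \<open>\<nu>\<close>.\<close>
  define Z' where "Z' = (\<lambda>\<omega> s. (1 / a) *\<^sub>R Z \<omega> s)"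
  have Z'[measurable]: "case_prod Z' \<in> borel_measurable (M \<Otimes>\<^sub>M \<nu>)"
    using Z unfolding Z'_def by measurable
  have sq: "integrable (M \<Otimes>\<^sub>M \<nu>) (\<lambda>(\<omega>, s). (norm (Z' \<omega> s))\<^sup>2)"
    using integrable_mult_right[OF integrable_power2_brownian_field[OF assms(3) a Z eq], of "(1 / a)\<^sup>2"]
    by (simp add: Z'_def \<nu>_def power_mult_distrib power_divide case_prod_unfold)
  have k: "\<forall>\<^sub>F t in at_top. \<forall>s. 0 \<le> k t s \<and> k t s \<le> 1"
    using eventually_gt_at_top[of 0] by eventually_elim (use c in \<open>auto simp: k_def\<close>)
  have k_lim: "((\<lambda>t. k t s) \<longlongrightarrow> 1) at_top" for s
  proof -
    have "((\<lambda>t. - s\<^sup>2 / (2 * c * t)) \<longlongrightarrow> 0) at_top"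
      using c by (intro real_tendsto_divide_at_top[OF tendsto_const]
          filterlim_tendsto_pos_mult_at_top[OF tendsto_const]) (auto simp: filterlim_ident)
    from tendsto_exp[OF this] show ?thesis
      by (simp add: k_def)
  qed
  have k_meas: "k t \<in> borel_measurable \<nu>" for t
    unfolding k_def by measurable
  have \<nu>: "prob_space \<nu>"
    unfolding \<nu>_def by (rule prob_space_exponential_density[OF a])
  note averages = tendsto_damped_average[OF prob_space_axioms \<nu> Z' sq k_meas k k_lim]
  have LINT_\<nu>: "(LINT s|\<nu>. h s *\<^sub>R Z' \<omega> s)
      = (LINT s:{0..}|lborel. exp (- (s * a)) *\<^sub>R (h s *\<^sub>R Z \<omega> s))"
    if "\<omega> \<in> space M" and [measurable]: "h \<in> borel_measurable borel" for h \<omega>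
  proof -
    have [measurable]: "Z \<omega> \<in> borel_measurable borel"
      using Z that(1) by measurable
    have "(LINT s|\<nu>. h s *\<^sub>R Z' \<omega> s) = (1 / a) *\<^sub>R (LINT s|\<nu>. h s *\<^sub>R Z \<omega> s)"
      by (simp add: Z'_def scaleR_left_commute[of _ "1 / a"] del: scaleR_scaleR)
    also have "\<dots> = (LINT s:{0..}|lborel. exp (- (s * a)) *\<^sub>R (h s *\<^sub>R Z \<omega> s))"
      using a by (simp add: \<nu>_def LINT_exponential_density)
    finally show ?thesis .
  qed
  have eq_scaled: "AE \<omega> in M. \<forall>t>0. v_scaled \<alpha> (ext_path W \<omega>) t \<eta> = (LINT s|\<nu>. k t s *\<^sub>R Z' \<omega> s)"
    using eq AE_space
  proof eventually_elim
    case (elim \<omega>)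
    have [measurable]: "Z \<omega> \<in> borel_measurable borel"
      using Z elim(2) by measurable
    have "v_scaled \<alpha> (Z \<omega>) t \<eta> = (LINT s|\<nu>. k t s *\<^sub>R Z' \<omega> s)" if "0 < t" for t
      using LINT_\<nu>[OF elim(2), of "k t"]
        v_scaled_eq_damped_Laplace[OF \<open>Z \<omega> \<in> borel_measurable borel\<close> Z0 assms(1) that c c_def]
      by (simp add: k_def a_def)
    then show ?case
      using elim(1) by simp
  qed
  have eq_limit: "AE \<omega> in M. v_limit \<alpha> (ext_path W \<omega>) \<eta> = (LINT s|\<nu>. Z' \<omega> s)"
    using eq AE_space
  proof eventually_elim
    case (elim \<omega>)
    show ?case
      using LINT_\<nu>[OF elim(2), of "\<lambda>_. 1"] elim(1) by (simp add: v_limit_def a_def c_def)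
  qed
  have "AE \<omega> in M. ((\<lambda>t. v_scaled \<alpha> (ext_path W \<omega>) t \<eta>) \<longlongrightarrow> v_limit \<alpha> (ext_path W \<omega>) \<eta>) at_top"
    using averages(1) eq_scaled eq_limit
  proof eventually_elim
    case (elim \<omega>)
    have "\<forall>\<^sub>F t in at_top. (LINT s|\<nu>. k t s *\<^sub>R Z' \<omega> s) = v_scaled \<alpha> (ext_path W \<omega>) t \<eta>"
      using eventually_gt_at_top[of 0] by eventually_elim (simp add: elim(2))
    from Lim_transform_eventually[OF elim(1) this] show ?case
      by (simp add: elim(3))
  qed
  moreover have "tendsto_L2 M (\<lambda>t \<omega>. v_scaled \<alpha> (ext_path W \<omega>) t \<eta>)
      (\<lambda>\<omega>. v_limit \<alpha> (ext_path W \<omega>) \<eta>) at_top"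
  proof (rule tendsto_L2_cong_AE[OF averages(2,3) _ eq_limit averages(4,5,6)])
    show "\<forall>\<^sub>F t in at_top. AE \<omega> in M. v_scaled \<alpha> (ext_path W \<omega>) t \<eta> = (LINT s|\<nu>. k t s *\<^sub>R Z' \<omega> s)"
      using eventually_gt_at_top[of 0]
    proof eventually_elim
      case (elim t)
      from eq_scaled show ?case
        by eventually_elim (use elim in blast)
    qed
  qed
  ultimately show ?thesis
    by blast
qed

end
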